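(* Fix $k$ and the type parameters $(v_j,p_j)_{j\in[k]}$. For every $i,j\in[k]$ with $i<j$ there exists a constant $R_{ij}$ (not depending on $B$ or on the vectors below) such that for every $B\in\mathbb N$, all $\vec y,\vec n\in\mathbb N^k$ (past accepted arrivals and future arrivals) and every optimal solution $\vec x^\star$ of the offline problem $P(\vec y,\vec n)$, at least one of the following two is true: (i) $x_i^\star>n_i-R_{ij}/p_i$; (ii) $x_j^\star<R_{ij}/p_j$.
   Context: $[k]=\{1,\dots,k\}$, $\mathbb N=\{0,1,2,\dots\}$. There are $k$ customer types; type $j$ has revenue $0\le v_j<1$ and show-up probability $p_j\in\mathbb Q\cap(0,1]$. The critical ratio is $q_j=v_j/p_j$, assumed to satisfy $q_j<1$ for all $j$. Types are ordered so that $q_1\ge\dots\ge q_k$, and if $q_j=q_{j+1}$ then $v_j>v_{j+1}$ and $p_j>p_{j+1}$. $B\in\mathbb N$ is the capacity. For $m\in\mathbb N$, $X_{j,m}\sim\mathrm{Bin}(m,p_j)$, independent across types $j$, and $V_B(\vec x)=\mathbb E\big[\big(\sum_jX_{j,x_j}-B\big)^+\big]$ for $\vec x\in\mathbb N^k$. Given past accepted customers $\vec y\in\mathbb N^k$ and numbers of future arrivals $\vec n\in\mathbb N^k$, the offline problem $P(\vec y,\vec n)$ is to maximize $\sum_jv_j(y_j+x_j)-V_B(\vec y+\vec x)$ over $\vec x\in\mathbb N^k$ with $0\le x_j\le n_j$ for all $j$. *)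

theory Defs
  imports "HOL-Probability.Probability"
begin

text \<open>
  Customer types are the indices \<open>{1..k}\<close>. A vector in \<open>\<nat>\<^sup>k\<close> is a function \<open>nat \<Rightarrow> nat\<close> of which only
  the values on \<open>{1..k}\<close> matter: every notion below ignores the values outside \<open>{1..k}\<close>.
\<close>

definition crit_ratio :: "(nat \<Rightarrow> real) \<Rightarrow> (nat \<Rightarrow> real) \<Rightarrow> nat \<Rightarrow> real" where
  "crit_ratio v p j = v j / p j"

definition show_ups :: "nat \<Rightarrow> (nat \<Rightarrow> real) \<Rightarrow> (nat \<Rightarrow> nat) \<Rightarrow> (nat \<Rightarrow> nat) pmf" where
  "show_ups k p x = Pi_pmf {1..k} 0 (\<lambda>j. binomial_pmf (x j) (p j))"

definition overbooking_cost :: "nat \<Rightarrow> (nat \<Rightarrow> real) \<Rightarrow> nat \<Rightarrow> (nat \<Rightarrow> nat) \<Rightarrow> real" where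
  "overbooking_cost k p B x =
     measure_pmf.expectation (show_ups k p x) (\<lambda>X. max 0 (real (\<Sum>j=1..k. X j) - real B))"

definition offline_objective ::
  "nat \<Rightarrow> (nat \<Rightarrow> real) \<Rightarrow> (nat \<Rightarrow> real) \<Rightarrow> nat \<Rightarrow> (nat \<Rightarrow> nat) \<Rightarrow> (nat \<Rightarrow> nat) \<Rightarrow> real" where
  "offline_objective k v p B y x =
     (\<Sum>j=1..k. v j * real (y j + x j)) - overbooking_cost k p B (\<lambda>j. y j + x j)"

definition offline_feasible :: "nat \<Rightarrow> (nat \<Rightarrow> nat) \<Rightarrow> (nat \<Rightarrow> nat) \<Rightarrow> bool" where
  "offline_feasible k n x \<longleftrightarrow> (\<forall>j\<in>{1..k}. x j \<le> n j)"

definition offline_optimal ::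
  "nat \<Rightarrow> (nat \<Rightarrow> real) \<Rightarrow> (nat \<Rightarrow> real) \<Rightarrow> nat \<Rightarrow> (nat \<Rightarrow> nat) \<Rightarrow> (nat \<Rightarrow> nat) \<Rightarrow> (nat \<Rightarrow> nat) \<Rightarrow> bool" where
  "offline_optimal k v p B y n x \<longleftrightarrow>
     is_arg_max (offline_objective k v p B y) (offline_feasible k n) x"

end

theory Submission
  imports Defs
begin

text \<open>
  Since the show-up probabilities are rational, there are positive \<open>a\<close>, \<open>b\<close> with
  \<open>a p\<^sub>i = b p\<^sub>j = c\<close>. If \<open>x\<^sub>j\<close> and \<open>n\<^sub>i - x\<^sub>i\<close> are both large, one may trade customers of type \<open>j\<close>
  for customers of type \<open>i\<close> at the rate \<open>b : a\<close>, which keeps the mean number of show-ups.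

  If \<open>q\<^sub>i > q\<^sub>j\<close>, trading \<open>N b\<close> for \<open>N a\<close> customers earns \<open>N c (q\<^sub>i - q\<^sub>j)\<close>, while the overbooking cost
  moves by at most the standard deviation scale \<open>O(\<surd>N)\<close>; a large fixed \<open>N\<close> contradicts optimality.

  If \<open>q\<^sub>i = q\<^sub>j\<close>, then \<open>p\<^sub>i > p\<^sub>j\<close> and trading \<open>b\<close> for \<open>a < b\<close> customers is revenue neutral, but it makes the
  number of show-ups smaller in convex order, strictly so at \<open>B\<close> unless the number of show-ups
  is surely at most \<open>B\<close> or surely at least \<open>B\<close>. In the first case the trade frees a seat for an
  additional customer of type \<open>i\<close>; in the second, dropping a customer of type \<open>j\<close> gains \<open>p\<^sub>j - v\<^sub>j > 0\<close>.
\<close>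

section \<open>Averaging operators of Bernoulli trials\<close>

text \<open>
  \<open>thin r f w\<close> is the expectation of \<open>f (w + X)\<close> for a Bernoulli variable \<open>X\<close> with parameter \<open>r\<close>. Hence
  \<open>thin r = I + r \<Delta>\<close> with the forward difference \<open>\<Delta>\<close>, so these operators commute, and comparing sums of
  independent Bernoulli variables becomes polynomial algebra in \<open>\<Delta>\<close>.
\<close>

definition thin :: "real \<Rightarrow> (nat \<Rightarrow> real) \<Rightarrow> nat \<Rightarrow> real" where
  "thin r f w = (1 - r) * f w + r * f (Suc w)"

lemma thin_commute: "thin r (thin s f) = thin s (thin r f)"
  by (auto simp: thin_def algebra_simps)

lemma thin_funpow_commute: "(thin r ^^ m) (thin s f) = thin s ((thin r ^^ m) f)"
  by (induction m) (auto simp: thin_commute)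

lemma thin_0 [simp]: "thin 0 f = f"
  by (auto simp: thin_def)

lemma thin_funpow_mono:
  assumes "0 \<le> r" "r \<le> 1" "\<And>w. f w \<le> g w"
  shows "(thin r ^^ m) f w \<le> (thin r ^^ m) g w"
proof (induction m arbitrary: w)
  case (Suc m)
  then show ?case using assms(1,2)
    by (auto simp: thin_def intro!: add_mono mult_left_mono)
qed (use assms in auto)

lemma thin_funpow_linear:
  "(thin r ^^ m) (\<lambda>w. f w + c * g w) = (\<lambda>w. (thin r ^^ m) f w + c * (thin r ^^ m) g w)"
  by (induction m) (auto simp: thin_def algebra_simps)

lemma thin_funpow_const [simp]: "(thin r ^^ m) (\<lambda>w. c) = (\<lambda>w. c)"
  by (induction m) (auto simp: thin_def algebra_simps)

lemma thin_funpow_nonneg: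
  assumes "0 \<le> r" "r \<le> 1" "\<And>w. 0 \<le> f w"
  shows "0 \<le> (thin r ^^ m) f w"
  using thin_funpow_mono[of r "\<lambda>_. 0" f m w] assms by simp

lemma thin_funpow_square:
  "(thin r ^^ m) (\<lambda>w. (real w - c)\<^sup>2) =
     (\<lambda>w. (real w + real m * r - c)\<^sup>2 + real m * r * (1 - r))"
proof (induction m)
  case (Suc m)
  show ?case unfolding funpow.simps o_def Suc
    by (rule ext) (simp add: thin_def algebra_simps power2_eq_square)
qed auto

section \<open>Mean overbooking cost: concentration and convex order\<close>

definition excess :: "nat \<Rightarrow> nat \<Rightarrow> real" where
  "excess B s = max 0 (real s - real B)"

text \<open>\<open>spike B = \<Delta>\<^sup>2 (excess B)\<close>.\<close>

definition spike :: "nat \<Rightarrow> nat \<Rightarrow> real" where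
  "spike B s = (if Suc s = B then 1 else 0)"

lemma spike_nonneg: "0 \<le> spike B s"
  by (simp add: spike_def)

lemma excess_diff2: "excess B (Suc (Suc s)) = 2 * excess B (Suc s) - excess B s + spike B s"
  by (auto simp: excess_def spike_def max_def)

text \<open>As \<open>excess B\<close> is 1-Lipschitz, averaging moves it from its value at the mean
  by at most the mean absolute deviation. With \<open>e\<close> of order the square root of
  \<open>m * r\<close> this is the standard deviation scale.\<close>

lemma thin_funpow_excess_bounds:
  assumes "0 \<le> r" "r \<le> 1" "0 < e"
  shows "\<bar>(thin r ^^ m) (excess B) w - max 0 (real w + real m * r - real B)\<bar> \<le> real m * r / (2 * e) + e / 2"
proof -
  define c where "c = real w + real m * r"
  define t where "t = max 0 (c - real B)"
  (* A quadratic majorant of the absolute value replaces the Cauchy-Schwarz bound by the variance. *)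
  have young: "\<bar>u\<bar> \<le> u\<^sup>2 / (2 * e) + e / 2" for u :: real
  proof -
    have "0 \<le> (\<bar>u\<bar> - e)\<^sup>2" by simp
    then have "2 * e * \<bar>u\<bar> \<le> u\<^sup>2 + e\<^sup>2" by (simp add: power2_eq_square algebra_simps)
    then show ?thesis using assms(3) by (simp add: field_simps power2_eq_square)
  qed
  have dist: "\<bar>excess B s - t\<bar> \<le> (real s - c)\<^sup>2 / (2 * e) + e / 2" for s
    using young[of "real s - c"] unfolding excess_def t_def by linarith
  \<comment> \<open>\<open>k = 1\<close> and \<open>k = -1\<close> give the averages of the upper
    and lower quadratic envelopes.\<close>
  have val: "(thin r ^^ m) (\<lambda>s. (t + k * (e / 2)) + k / (2 * e) * (real s - c)\<^sup>2) w
      = t + k * (e / 2) + k / (2 * e) * (real m * r * (1 - r))" for k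
    unfolding thin_funpow_linear thin_funpow_square by (simp add: c_def)
  have le: "real m * r * (1 - r) / (2 * e) \<le> real m * r / (2 * e)"
    using assms by (intro divide_right_mono mult_left_le) auto
  have "(thin r ^^ m) (excess B) w \<le> t + 1 * (e / 2) + 1 / (2 * e) * (real m * r * (1 - r))"
    unfolding val[symmetric] using dist assms
    by (intro thin_funpow_mono) (auto simp: abs_le_iff algebra_simps)
  moreover have "t + (-1) * (e / 2) + (-1) / (2 * e) * (real m * r * (1 - r)) \<le> (thin r ^^ m) (excess B) w"
    unfolding val[symmetric] using dist assms
    by (intro thin_funpow_mono) (auto simp: abs_le_iff algebra_simps)
  ultimately show ?thesis
    using le unfolding t_def c_def by (simp add: abs_le_iff)
qed

text \<open>
  Interpolating with \<open>c\<^sub>k = (I + r' \<Delta>)\<^sup>k (I + r \<Delta>)\<^bsup>n - k\<^esup> (I + k (r - r') \<Delta>)\<close>, which has the same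
  \<open>\<Delta>\<close>-coefficient for all \<open>k\<close>, each step gains \<open>(r - r')\<^sup>2 (n - k) \<Delta>\<^sup>2\<close> times a product of operators; only
  the last of these gains is kept.
\<close>

lemma thin_spread_step:
  fixes r :: real
  assumes "n \<ge> 1" "0 \<le> r" "r \<le> 1"
  defines "r' \<equiv> real n * r / real (Suc n)"
  shows "(thin r' ^^ Suc n) (excess B) w \<ge>
         (thin r ^^ n) (excess B) w + (r - r')\<^sup>2 * (thin r' ^^ (n - 1)) (spike B) w"
proof -
  define d where "d = r - r'"
  have r': "r' = real n * d" and r: "r = real (Suc n) * d"
    unfolding d_def r'_def by (auto simp: field_simps)
  have r'01: "0 \<le> r'" "r' \<le> 1"
    using assms(1-3) mult_mono[of "real n" "real (Suc n)" r 1] unfolding r'_def by (auto simp: field_simps)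
  define c where "c k = (thin r' ^^ k) ((thin r ^^ (n - k)) (thin (real k * d) (excess B)))" for k
  \<comment> \<open>The linear coefficients agree, \<open>r' + (k + 1) * d = r + k * d\<close>; the
    quadratic ones differ by \<open>d * d * (n * (k + 1) - (n + 1) * k)\<close>.\<close>
  have pair: "thin r' (thin (real (Suc k) * d) (excess B)) =
     (\<lambda>w. thin r (thin (real k * d) (excess B)) w + d\<^sup>2 * (real n - real k) * spike B w)" for k
    by (rule ext) (simp add: thin_def r' r excess_diff2 algebra_simps power2_eq_square)
  have step: "c (Suc k) = (\<lambda>w. c k w + d\<^sup>2 * (real n - real k) *
      (thin r' ^^ k) ((thin r ^^ (n - Suc k)) (spike B)) w)" if "k < n" for k
  proof -
    have "c (Suc k) = (thin r' ^^ k) ((thin r ^^ (n - Suc k)) (thin r' (thin (real (Suc k) * d) (excess B))))"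
      unfolding c_def by (simp add: thin_funpow_commute)
    moreover have "c k = (thin r' ^^ k) ((thin r ^^ (n - Suc k)) (thin r (thin (real k * d) (excess B))))"
      using that unfolding c_def by (simp add: Suc_diff_Suc[symmetric] thin_funpow_commute)
    ultimately show ?thesis by (simp only: pair thin_funpow_linear)
  qed
  have mono: "k \<le> n \<Longrightarrow> c 0 w \<le> c k w" for k
  proof (induction k)
    case (Suc k)
    have "0 \<le> (thin r' ^^ k) ((thin r ^^ (n - Suc k)) (spike B)) w"
      using assms r'01 by (intro thin_funpow_nonneg) (auto simp: spike_nonneg)
    then show ?case using Suc by (auto simp: step intro!: add_increasing2)
  qed simp
  have "c n w = c (n - 1) w + d\<^sup>2 * (thin r' ^^ (n - 1)) (spike B) w"
    using step[of "n - 1"] assms(1) by (simp add: of_nat_diff)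
  moreover have "c n = (thin r' ^^ Suc n) (excess B)"
    unfolding c_def by (simp add: r'[symmetric] thin_funpow_commute)
  moreover have "c 0 = (thin r ^^ n) (excess B)" unfolding c_def by simp
  ultimately show ?thesis using mono[of "n - 1"] by (simp add: d_def)
qed

text \<open>Chains the one-trial spreads at constant mean from \<open>a\<close> to \<open>b\<close>
  trials; keeping the gain of the last one gives an \<open>e\<close> uniform in \<open>B\<close> and
  \<open>w\<close>.\<close>

lemma thin_spread:
  fixes r s :: real
  assumes "1 \<le> a" "a < b" "0 < r" "r \<le> 1" "real a * r = real b * s"
  shows "\<exists>e>0. \<forall>B w. (thin s ^^ b) (excess B) w \<ge>
           (thin r ^^ a) (excess B) w + e * (thin s ^^ (b - 2)) (spike B) w"
proof -
  define rr where "rr n = real a * r / real n" for n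
  have rr01: "0 < rr n \<and> rr n \<le> 1" if "a \<le> n" for n
  proof -
    have "0 < real a * r" using assms by (intro mult_pos_pos) auto
    moreover have "real a * r \<le> real n"
      using that assms mult_mono[of "real a" "real n" r 1] by auto
    ultimately show ?thesis using that assms by (simp add: rr_def)
  qed
  have spread: "(thin (rr (Suc n)) ^^ Suc n) (excess B) w \<ge> (thin (rr n) ^^ n) (excess B) w +
     (rr n - rr (Suc n))\<^sup>2 * (thin (rr (Suc n)) ^^ (n - 1)) (spike B) w" if "a \<le> n" for n B w
  proof -
    have "rr (Suc n) = real n * rr n / real (Suc n)"
      using that assms by (simp add: rr_def)
    then show ?thesis
      using thin_spread_step[of n "rr n" B w] rr01[OF that] that assms by simp
  qed
  have mono: "(thin (rr a) ^^ a) (excess B) w \<le> (thin (rr n) ^^ n) (excess B) w" if "a \<le> n" for n B w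
    using that
  proof (induction n rule: dec_induct)
    case (step n)
    have "0 \<le> (thin (rr (Suc n)) ^^ (n - 1)) (spike B) w"
      using rr01[of "Suc n"] step by (intro thin_funpow_nonneg) (auto simp: spike_nonneg)
    then have "0 \<le> (rr n - rr (Suc n))\<^sup>2 * (thin (rr (Suc n)) ^^ (n - 1)) (spike B) w"
      by simp
    then show ?case using step spread[of n B w] by linarith
  qed simp
  define m where "m = b - 1"
  have m: "a \<le> m" "b = Suc m" using assms by (auto simp: m_def)
  have "rr a = r" "rr b = s" using assms by (auto simp: rr_def field_simps)
  moreover have "0 < real a * r" using assms by (intro mult_pos_pos) auto
  then have "rr m \<noteq> rr b"
    unfolding rr_def divide_cancel_left of_nat_eq_iff using m by (auto simp: zero_less_mult_iff)
  ultimately have e: "0 < (rr m - rr b)\<^sup>2" and rr: "rr a = r" "rr b = s" by simp_all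
  have "(thin r ^^ a) (excess B) w + (rr m - rr b)\<^sup>2 * (thin s ^^ (b - 2)) (spike B) w
      \<le> (thin s ^^ b) (excess B) w" for B w
    using spread[OF m(1), of B w] mono[OF m(1), of B w] unfolding m(2)[symmetric] rr
    by (simp add: m_def numeral_2_eq_2)
  with e show ?thesis by blast
qed

section \<open>Law of the total number of show-ups\<close>

definition total_show_ups :: "nat \<Rightarrow> (nat \<Rightarrow> real) \<Rightarrow> (nat \<Rightarrow> nat) \<Rightarrow> nat pmf" where
  "total_show_ups k p z = map_pmf (\<lambda>X. \<Sum>j=1..k. X j) (show_ups k p z)"

lemma overbooking_cost_eq:
  "overbooking_cost k p B z = measure_pmf.expectation (total_show_ups k p z) (excess B)"
  by (simp add: overbooking_cost_def total_show_ups_def excess_def)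

lemma total_show_ups_split:
  assumes "i \<in> {1..k}"
  shows "total_show_ups k p z = binomial_pmf (z i) (p i) \<bind> (\<lambda>m.
           map_pmf (\<lambda>X. m + (\<Sum>j\<in>{1..k} - {i}. X j))
             (Pi_pmf ({1..k} - {i}) 0 (\<lambda>j. binomial_pmf (z j) (p j))))"
proof -
  define A where "A = {1..k} - {i}"
  have A: "finite A" "i \<notin> A" "{1..k} = insert i A"
    using assms by (auto simp: A_def)
  have "(\<Sum>j\<in>A. if j = i then m else X j) = sum X A" for m and X :: "nat \<Rightarrow> nat"
    using A by (intro sum.cong) auto
  then show ?thesis
    unfolding total_show_ups_def show_ups_def A_def[symmetric] unfolding A(3)
    by (subst Pi_pmf_insert')
       (use A in \<open>simp_all add: map_pmf_def bind_assoc_pmf bind_return_pmf\<close>)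
qed

lemma total_show_ups_Suc:
  assumes "i \<in> {1..k}" "p i \<in> {0..1}"
  shows "total_show_ups k p (z(i := Suc (z i))) =
           total_show_ups k p z \<bind> (\<lambda>s. map_pmf (\<lambda>b. s + of_bool b) (bernoulli_pmf (p i)))"
proof -
  have rest: "Pi_pmf ({1..k} - {i}) 0 (\<lambda>j. binomial_pmf ((z(i := Suc (z i))) j) (p j)) =
        Pi_pmf ({1..k} - {i}) 0 (\<lambda>j. binomial_pmf (z j) (p j))" (is "_ = ?P")
    by (intro Pi_pmf_cong) auto
  have "total_show_ups k p (z(i := Suc (z i))) =
     bernoulli_pmf (p i) \<bind> (\<lambda>b. binomial_pmf (z i) (p i) \<bind> (\<lambda>m. ?P \<bind> (\<lambda>X.
       return_pmf (m + (\<Sum>j\<in>{1..k} - {i}. X j) + of_bool b))))"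
    unfolding total_show_ups_split[OF assms(1)] rest
    by (simp add: binomial_pmf_Suc[OF assms(2)] map_pmf_def bind_assoc_pmf bind_return_pmf)
       (auto intro!: bind_pmf_cong simp: ac_simps)
  also have "\<dots> = binomial_pmf (z i) (p i) \<bind> (\<lambda>m. ?P \<bind> (\<lambda>X. bernoulli_pmf (p i) \<bind> (\<lambda>b.
       return_pmf (m + (\<Sum>j\<in>{1..k} - {i}. X j) + of_bool b))))"
    by (simp only: bind_commute_pmf[of "bernoulli_pmf (p i)"])
  also have "\<dots> = total_show_ups k p z \<bind> (\<lambda>s. map_pmf (\<lambda>b. s + of_bool b) (bernoulli_pmf (p i)))"
    unfolding total_show_ups_split[OF assms(1)]
    by (simp add: map_pmf_def bind_assoc_pmf bind_return_pmf)
  finally show ?thesis .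
qed

text \<open>A type with \<open>p j = 1\<close> shows up in full; any other count takes every value
  from \<open>0\<close> to \<open>z j\<close>.\<close>

lemma set_total_show_ups:
  assumes "\<forall>j\<in>{1..k}. 0 < p j \<and> p j \<le> 1"
  shows "set_pmf (total_show_ups k p z) =
    {(\<Sum>j=1..k. X j) | X. \<forall>j\<in>{1..k}. (if p j = 1 then z j else 0) \<le> X j \<and> X j \<le> z j}"
proof -
  have bin: "set_pmf (binomial_pmf (z j) (p j)) = {(if p j = 1 then z j else 0)..z j}"
    if "j \<in> {1..k}" for j
  proof -
    have "0 < p j" "p j \<le> 1" using assms that by auto
    then show ?thesis by (subst set_pmf_binomial_eq) auto
  qed
  have "(\<Sum>j=1..k. X j) \<in> set_pmf (total_show_ups k p z)"
    if "\<forall>j\<in>{1..k}. (if p j = 1 then z j else 0) \<le> X j \<and> X j \<le> z j" for X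
  proof -
    \<comment> \<open>\<open>Pi_pmf\<close> lives on functions with the default \<open>0\<close>
      outside \<open>{1..k}\<close>.\<close>
    define X' where "X' j = (if j \<in> {1..k} then X j else 0)" for j
    have "X' \<in> set_pmf (show_ups k p z)"
      using that bin by (auto simp: show_ups_def set_Pi_pmf PiE_dflt_def X'_def)
    moreover have "(\<Sum>j=1..k. X j) = (\<Sum>j=1..k. X' j)"
      by (intro sum.cong) (auto simp: X'_def)
    ultimately show ?thesis by (auto simp: total_show_ups_def)
  qed
  moreover have "\<exists>X. s = (\<Sum>j=1..k. X j) \<and> (\<forall>j\<in>{1..k}. (if p j = 1 then z j else 0) \<le> X j \<and> X j \<le> z j)"
    if "s \<in> set_pmf (total_show_ups k p z)" for s
  proof -
    obtain X where "X \<in> set_pmf (show_ups k p z)" "s = (\<Sum>j=1..k. X j)"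
      using \<open>s \<in> _\<close> by (auto simp: total_show_ups_def)
    moreover from this have "X j \<in> {(if p j = 1 then z j else 0)..z j}" if "j \<in> {1..k}" for j
      unfolding bin[OF that, symmetric] using that
      by (auto simp: show_ups_def set_Pi_pmf PiE_dflt_def)
    ultimately show ?thesis by (intro exI[of _ X]) (metis atLeastAtMost_iff)
  qed
  ultimately show ?thesis by blast
qed

lemma total_show_ups_bounds:
  assumes "\<forall>j\<in>{1..k}. 0 < p j \<and> p j \<le> 1" "s \<in> set_pmf (total_show_ups k p z)"
  shows "(\<Sum>j=1..k. if p j = 1 then z j else 0) \<le> s" "s \<le> (\<Sum>j=1..k. z j)"
  using assms by (auto simp: set_total_show_ups intro!: sum_mono)

lemma finite_set_total_show_ups:
  assumes "\<forall>j\<in>{1..k}. 0 < p j \<and> p j \<le> 1"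
  shows "finite (set_pmf (total_show_ups k p z))"
  using total_show_ups_bounds(2)[OF assms, of _ z] by (auto intro: finite_subset[of _ "{..\<Sum>j=1..k. z j}"])

lemma sum_between:
  fixes l u :: "'a \<Rightarrow> nat"
  assumes "finite A" "\<forall>j\<in>A. l j \<le> u j" "sum l A \<le> s" "s \<le> sum u A"
  shows "\<exists>X. sum X A = s \<and> (\<forall>j\<in>A. l j \<le> X j \<and> X j \<le> u j)"
  using assms
proof (induction A arbitrary: s rule: finite_induct)
  case (insert i A)
  \<comment> \<open>The least choice for coordinate \<open>i\<close> whose remainder the others can
    still absorb.\<close>
  define t where "t = max (l i) (s - sum u A)"
  have "sum l A \<le> sum u A" using insert.prems(1) by (intro sum_mono) auto
  then have t: "l i \<le> t" "t \<le> u i" "t \<le> s" "sum l A \<le> s - t" "s - t \<le> sum u A"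
    using insert by (auto simp: t_def)
  obtain X where X: "sum X A = s - t" "\<forall>j\<in>A. l j \<le> X j \<and> X j \<le> u j"
    using insert.IH[of "s - t"] insert.prems(1) t by auto
  have "sum (X(i := t)) A = sum X A" using insert.hyps by (intro sum.cong) auto
  then show ?case using X t insert.hyps by (intro exI[of _ "X(i := t)"]) auto
qed auto

text \<open>The support has no gaps; this later puts mass on \<open>B - 1\<close>, where
  \<open>spike B\<close> is nonzero.\<close>

lemma total_show_ups_interval:
  assumes "\<forall>j\<in>{1..k}. 0 < p j \<and> p j \<le> 1"
    and "(\<Sum>j=1..k. if p j = 1 then z j else 0) \<le> s" "s \<le> (\<Sum>j=1..k. z j)"
  shows "s \<in> set_pmf (total_show_ups k p z)"
proof -
  have "\<exists>X. sum X {1..k} = s \<and>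
      (\<forall>j\<in>{1..k}. (if p j = 1 then z j else 0) \<le> X j \<and> X j \<le> z j)"
    using assms by (intro sum_between) auto
  then show ?thesis unfolding set_total_show_ups[OF assms(1)] by blast
qed

text \<open>Turns extra customers into operators on the integrand, so that costs can be compared
  pointwise under one common law.\<close>

lemma expectation_total_add:
  fixes g :: "nat \<Rightarrow> real"
  assumes p: "\<forall>j\<in>{1..k}. 0 < p j \<and> p j \<le> 1" and i: "i \<in> {1..k}"
  shows "measure_pmf.expectation (total_show_ups k p (z(i := z i + m))) g =
         measure_pmf.expectation (total_show_ups k p z) ((thin (p i) ^^ m) g)"
proof (induction m arbitrary: g)
  case (Suc m)
  define z' where "z' = z(i := z i + m)"
  have pi: "0 \<le> p i" "p i \<le> 1" using p i by (auto intro: less_imp_le)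
  have "z(i := z i + Suc m) = z'(i := Suc (z' i))" by (auto simp: z'_def)
  then have "measure_pmf.expectation (total_show_ups k p (z(i := z i + Suc m))) g =
    (\<Sum>s\<in>set_pmf (total_show_ups k p z'). pmf (total_show_ups k p z') s *
       measure_pmf.expectation (map_pmf (\<lambda>b. s + of_bool b) (bernoulli_pmf (p i))) g)"
    using pi finite_set_total_show_ups[OF p]
    by (simp only:, subst total_show_ups_Suc[OF i], simp,
        subst pmf_expectation_bind[of "set_pmf (total_show_ups k p z')"]) auto
  also have "\<dots> = measure_pmf.expectation (total_show_ups k p z') (thin (p i) g)"
    using pi finite_set_total_show_ups[OF p]
    by (subst integral_measure_pmf[of "set_pmf (total_show_ups k p z')"])
       (auto simp: thin_def algebra_simps)
  also have "\<dots> = measure_pmf.expectation (total_show_ups k p z) ((thin (p i) ^^ Suc m) g)"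
    unfolding z'_def Suc by (simp add: thin_funpow_commute)
  finally show ?case .
qed simp

lemma expectation_total_mono:
  fixes f g :: "nat \<Rightarrow> real"
  assumes "\<forall>j\<in>{1..k}. 0 < p j \<and> p j \<le> 1"
    and "\<And>s. s \<in> set_pmf (total_show_ups k p z) \<Longrightarrow> f s \<le> g s + c * h s"
  shows "measure_pmf.expectation (total_show_ups k p z) f \<le>
         measure_pmf.expectation (total_show_ups k p z) g +
         c * measure_pmf.expectation (total_show_ups k p z) h"
proof -
  have int: "integrable (measure_pmf (total_show_ups k p z)) u" for u :: "nat \<Rightarrow> real"
    using finite_set_total_show_ups[OF assms(1)] by (rule integrable_measure_pmf_finite)
  have "measure_pmf.expectation (total_show_ups k p z) f \<le>
      measure_pmf.expectation (total_show_ups k p z) (\<lambda>s. g s + c * h s)"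
    using assms(2) by (intro integral_mono_AE int AE_pmfI)
  then show ?thesis by (simp add: int)
qed

section \<open>Exchanges at an optimal solution\<close>

text \<open>\<open>w\<close> is the part shared by both solutions: the optimal one adds
  \<open>b\<close> customers of type \<open>j\<close>, the rival adds \<open>a\<close> of type
  \<open>i\<close>.\<close>

lemma optimal_exchange:
  fixes x y :: "nat \<Rightarrow> nat"
  assumes p: "\<forall>j\<in>{1..k}. 0 < p j \<and> p j \<le> 1"
    and opt: "offline_optimal k v p B y n x"
    and ij: "i \<in> {1..k}" "j \<in> {1..k}" "i \<noteq> j"
    and ab: "x i + a \<le> n i" "b \<le> x j"
  defines "w \<equiv> (\<lambda>l. y l + x l)(j := y j + x j - b)"
  shows "real a * v i - real b * v j \<le>
    measure_pmf.expectation (total_show_ups k p w) ((thin (p i) ^^ a) (excess B)) -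
    measure_pmf.expectation (total_show_ups k p w) ((thin (p j) ^^ b) (excess B))"
proof -
  define x' where "x' = x(i := x i + a, j := x j - b)"
  have rev: "(\<Sum>l=1..k. v l * real ((w(m := w m + c)) l)) = (\<Sum>l=1..k. v l * real (w l)) + real c * v m"
    if "m \<in> {1..k}" for m c
    using that by (subst (1 2) sum.remove[of _ m]) (auto simp: algebra_simps)
  have "offline_feasible k n x'"
    using opt ij ab by (auto simp: offline_optimal_def is_arg_max_def offline_feasible_def x'_def
        intro: le_trans[OF diff_le_self])
  then have "offline_objective k v p B y x' \<le> offline_objective k v p B y x"
    using opt by (auto simp: offline_optimal_def is_arg_max_def not_less)
  moreover have obj: "offline_objective k v p B y u =
      (\<Sum>l=1..k. v l * real ((w(m := w m + c)) l)) -
      measure_pmf.expectation (total_show_ups k p (w(m := w m + c))) (excess B)"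
    if "(\<lambda>l. y l + u l) = w(m := w m + c)" for u m c
    unfolding that[symmetric] by (simp add: offline_objective_def overbooking_cost_eq)
  moreover have "(\<lambda>l. y l + x' l) = w(i := w i + a)" "(\<lambda>l. y l + x l) = w(j := w j + b)"
    using ij ab by (auto simp: w_def x'_def)
  ultimately show ?thesis
    by (simp only: obj rev ij expectation_total_add[OF p])
qed

text \<open>The revenue gain is linear in the traded mean \<open>a * p i\<close>, the fluctuation
  only of square root order, so optimality leaves room only for trades of bounded size.\<close>

lemma exchange_larger_ratio:
  fixes x y :: "nat \<Rightarrow> nat" and v p :: "nat \<Rightarrow> real"
  assumes p: "\<forall>j\<in>{1..k}. 0 < p j \<and> p j \<le> 1"
    and opt: "offline_optimal k v p B y n x"
    and ij: "i \<in> {1..k}" "j \<in> {1..k}" "i \<noteq> j"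
    and ab: "x i + a \<le> n i" "b \<le> x j" "real a * p i = real b * p j"
    and gap: "0 < crit_ratio v p i - crit_ratio v p j"
  shows "real a * p i * (crit_ratio v p i - crit_ratio v p j)\<^sup>2 \<le> 4"
proof -
  define g where "g = crit_ratio v p i - crit_ratio v p j"
  define c where "c = real a * p i"
  define w where "w = (\<lambda>l. y l + x l)(j := y j + x j - b)"
  define E :: "(nat \<Rightarrow> real) \<Rightarrow> real" where "E = measure_pmf.expectation (total_show_ups k p w)"
  have g: "0 < g" using gap by (simp add: g_def)
  have pij: "0 < p i" "p i \<le> 1" "0 < p j" "p j \<le> 1" using p ij by auto
  have "real a * v i - real b * v j = c * crit_ratio v p i - real b * p j * crit_ratio v p j"
    using pij by (simp add: c_def crit_ratio_def)
  also have "\<dots> = c * g"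
    unfolding ab(3)[symmetric] by (simp add: c_def g_def algebra_simps)
  finally have "c * g \<le> E ((thin (p i) ^^ a) (excess B)) - E ((thin (p j) ^^ b) (excess B))"
    using optimal_exchange[OF p opt ij ab(1,2)] by (simp add: w_def E_def)
  also have "(thin (p i) ^^ a) (excess B) s \<le>
      (thin (p j) ^^ b) (excess B) s + (c * g / 2 + 2 / g) * 1" for s
  proof -
    have "\<bar>(thin (p l) ^^ d) (excess B) s - max 0 (real s + c - real B)\<bar> \<le> c * g / 4 + 1 / g"
      if "real d * p l = c" "l = i \<or> l = j" for l d
      \<comment> \<open>With \<open>e = 2 / g\<close> the two errors add up to
        \<open>c * g / 2 + 2 / g\<close>, whose linear part is half of the gain
        \<open>c * g\<close>.\<close>
      using thin_funpow_excess_bounds[of "p l" "2 / g" d B s] that pij g by auto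
    from this[of a i] this[of b j] show ?thesis using ab(3) by (simp add: c_def abs_le_iff)
  qed
  then have "E ((thin (p i) ^^ a) (excess B)) - E ((thin (p j) ^^ b) (excess B))
      \<le> (c * g / 2 + 2 / g) * E (\<lambda>_. 1)"
    unfolding E_def by (subst diff_le_eq, subst add.commute, intro expectation_total_mono[OF p])
  finally have "c * g \<le> c * g / 2 + 2 / g" by (simp add: E_def)
  then have "c * g * g \<le> (c * g / 2 + 2 / g) * g" using g by (intro mult_right_mono) auto
  also have "\<dots> = c * g * g / 2 + 2" using g by (simp add: algebra_simps)
  finally have "c * g\<^sup>2 \<le> 4" by (simp add: power2_eq_square)
  then show ?thesis by (simp add: c_def g_def)
qed

text \<open>The slot beyond \<open>a\<close> is for the case in which capacity never binds: there
  only an additional customer of type \<open>i\<close> brings a profit.\<close>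

lemma exchange_equal_ratio:
  fixes x y :: "nat \<Rightarrow> nat" and v p :: "nat \<Rightarrow> real"
  assumes p: "\<forall>j\<in>{1..k}. 0 < p j \<and> p j \<le> 1"
    and opt: "offline_optimal k v p B y n x"
    and ij: "i \<in> {1..k}" "j \<in> {1..k}" "i \<noteq> j"
    and ab: "1 \<le> a" "x i + (a + 1) \<le> n i" "b \<le> x j" "real a * p i = real b * p j"
    and eq: "crit_ratio v p i = crit_ratio v p j" and less_1: "crit_ratio v p j < 1"
    and pij: "p j < p i" and vi: "0 < v i"
  shows False
proof -
  have p01: "0 < p i" "p i \<le> 1" "0 < p j" "p j < 1"
    using p ij pij by fastforce+
  have rev: "real a * v i = real b * v j"
  proof -
    have "real a * v i = real a * p i * crit_ratio v p i" using p01 by (simp add: crit_ratio_def)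
    also have "\<dots> = real b * p j * crit_ratio v p j" by (simp add: ab eq)
    finally show ?thesis using p01 by (simp add: crit_ratio_def)
  qed
  have "real b * p j < real b * p i" using ab p01 pij
    by (cases "b = 0") auto
  then have "real a * p i < real b * p i" using ab(4) by simp
  then have "a < b" using p01 by simp
  define z where "z = (\<lambda>l. y l + x l)"
  define E :: "(nat \<Rightarrow> nat) \<Rightarrow> (nat \<Rightarrow> real) \<Rightarrow> real"
    where "E u = measure_pmf.expectation (total_show_ups k p u)" for u
  define m where "m u = (\<Sum>l=1..k. if p l = 1 then u l else 0)" for u :: "nat \<Rightarrow> nat"
  define M where "M u = (\<Sum>l=1..k. u l)" for u :: "nat \<Rightarrow> nat"
  (* m u and M u are the least and the largest possible number of show-ups. *)
  have exch: "real c * v i - real d * v j \<le>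
      E (z(j := z j - d)) ((thin (p i) ^^ c) (excess B)) -
      E (z(j := z j - d)) ((thin (p j) ^^ d) (excess B))"
    if "c \<le> a + 1" "d \<le> b" for c d
    using optimal_exchange[OF p opt ij, of c d] that ab by (simp add: z_def E_def)
  have M_add: "M (u(l := u l + c)) = M u + c" if "l \<in> {1..k}" for u l c
    using that unfolding M_def by (subst (1 2) sum.remove[of _ l]) auto
  \<comment> \<open>Since \<open>p j < 1\<close>, type \<open>j\<close> has no sure
    show-ups.\<close>
  have m_upd: "m (u(j := c)) = m u" for u c
    using p01 unfolding m_def by (intro sum.cong) auto
  have z_restore: "z = (z(j := z j - d))(j := (z(j := z j - d)) j + d)" if "d \<le> b" for d
    using that ab by (auto simp: z_def)
  have M_sub: "M (z(j := z j - d)) + d = M z" if "d \<le> b" for d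
    using M_add[OF ij(2), of "z(j := z j - d)" d] z_restore[OF that] by simp
  consider "M z \<le> B" | "B \<le> m z" | "m z < B" "B < M z" by linarith
  then show False
  proof cases
    case 1
    have zero: "E u (excess B) = 0" if "M u \<le> B" for u
    proof -
      have "E u (excess B) = E u (\<lambda>_. 0)" unfolding E_def
        using that total_show_ups_bounds(2)[OF p, of _ u]
        by (intro integral_cong_AE AE_pmfI) (force simp: M_def excess_def)+
      then show ?thesis by (simp add: E_def)
    qed
    \<comment> \<open>As \<open>a + 1 \<le> b\<close>, the trade keeps the total at most
      \<open>B\<close>, so the cost stays zero while revenue grows by \<open>v i\<close>.\<close>
    define w where "w = z(j := z j - b)"
    have "E w ((thin (p i) ^^ (a + 1)) (excess B)) = 0" "E w ((thin (p j) ^^ b) (excess B)) = 0"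
      using M_sub[of b] 1 \<open>a < b\<close> M_add[OF ij(1), of w "a + 1"] M_add[OF ij(2), of w b]
        zero[of "w(i := w i + (a + 1))"] zero[of "w(j := w j + b)"]
        expectation_total_add[OF p ij(1), of w "a + 1" "excess B"]
        expectation_total_add[OF p ij(2), of w b "excess B"]
      by (simp_all add: E_def w_def)
    then have "real (a + 1) * v i \<le> real b * v j"
      using exch[of "a + 1" b] by (simp add: w_def)
    then show False using rev vi by (simp add: algebra_simps)
  next
    case 2
    \<comment> \<open>Without one customer of type \<open>j\<close> there are still surely
      \<open>B\<close> show-ups, so this customer costs \<open>p j\<close> on average.\<close>
    define w where "w = z(j := z j - 1)"
    have "excess B s \<le> thin (p j) (excess B) s + (- p j) * 1"
      if "s \<in> set_pmf (total_show_ups k p w)" for s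
    proof -
      have "m w \<le> s" unfolding m_def by (rule total_show_ups_bounds(1)[OF p that])
      then have "B \<le> s" using 2 m_upd[of z "z j - 1"] by (simp add: w_def)
      then show ?thesis by (simp add: thin_def excess_def algebra_simps)
    qed
    then have "E w (excess B) \<le> E w (thin (p j) (excess B)) + (- p j) * E w (\<lambda>_. 1)"
      unfolding E_def by (rule expectation_total_mono[OF p])
    then have "p j \<le> v j"
      using exch[of 0 1] \<open>a < b\<close> by (simp add: E_def w_def)
    then show False using less_1 p01 by (simp add: crit_ratio_def)
  next
    case 3
    define w where "w = z(j := z j - b)"
    \<comment> \<open>This is \<open>z\<close> with two customers of type \<open>j\<close> fewer;
      its largest total \<open>M z - 2\<close> still reaches \<open>B - 1\<close>.\<close>
    define w' where "w' = w(j := w j + (b - 2))"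
    have b2: "2 \<le> b" using \<open>a < b\<close> ab(1) by simp
    obtain e where e: "0 < e" "\<And>s. (thin (p i) ^^ a) (excess B) s \<le>
        (thin (p j) ^^ b) (excess B) s + (- e) * (thin (p j) ^^ (b - 2)) (spike B) s"
      using thin_spread[OF ab(1) \<open>a < b\<close> p01(1,2) ab(4)] by (force simp: algebra_simps)
    have "m w' \<le> B - 1" "B - 1 \<le> M w'"
      using 3 M_sub[of b] M_add[OF ij(2), of w "b - 2"] b2 m_upd
      by (simp_all add: w'_def w_def)
    then have "B - 1 \<in> set_pmf (total_show_ups k p w')"
      unfolding m_def M_def by (rule total_show_ups_interval[OF p])
    then have "0 < pmf (total_show_ups k p w') (B - 1)" by (simp add: pmf_positive)
    also have "\<dots> = E w' (spike B)"
      using 3 by (simp add: E_def, subst integral_measure_pmf[of "{B - 1}"]) (auto simp: spike_def split: if_splits)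
    also have "\<dots> = E w ((thin (p j) ^^ (b - 2)) (spike B))"
      unfolding E_def w'_def by (rule expectation_total_add[OF p ij(2)])
    finally have "0 < E w ((thin (p j) ^^ (b - 2)) (spike B))" .
    moreover have "E w ((thin (p i) ^^ a) (excess B)) \<le>
        E w ((thin (p j) ^^ b) (excess B)) + (- e) * E w ((thin (p j) ^^ (b - 2)) (spike B))"
      unfolding E_def by (rule expectation_total_mono[OF p e(2)])
    moreover have "0 \<le> E w ((thin (p i) ^^ a) (excess B)) - E w ((thin (p j) ^^ b) (excess B))"
      using exch[of a b] unfolding rev w_def by simp
    ultimately have "e * E w ((thin (p j) ^^ (b - 2)) (spike B)) \<le> 0" by linarith
    with \<open>0 < E w ((thin (p j) ^^ (b - 2)) (spike B))\<close> e(1) show False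
      by (simp add: mult_le_0_iff)
  qed
qed

section \<open>Rational trading rates and the order of the types\<close>

lemma commensurable:
  fixes r s :: real
  assumes "r \<in> \<rat>" "s \<in> \<rat>" "0 < r" "0 < s"
  obtains a b :: nat where "1 \<le> a" "1 \<le> b" "real a * r = real b * s"
proof -
  obtain m n where r: "n \<noteq> 0" "\<bar>r\<bar> = real m / real n"
    using Rats_abs_nat_div_natE[OF assms(1)] by metis
  obtain m' n' where s: "n' \<noteq> 0" "\<bar>s\<bar> = real m' / real n'"
    using Rats_abs_nat_div_natE[OF assms(2)] by metis
  have "m \<noteq> 0" "m' \<noteq> 0" using assms r s by (auto intro!: Nat.gr0I)
  moreover have "r = real m / real n" "s = real m' / real n'" using assms r s by simp_all
  ultimately show ?thesis
    using r(1) s(1) by (intro that[of "n * m'" "m * n'"]) auto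
qed

text \<open>Ratios never increase, so equality at the ends forces a tie at each step between, and
  the strict inequalities chain.\<close>

lemma ratio_order_lexicographic:
  fixes q v p :: "nat \<Rightarrow> real"
  assumes ordered: "\<And>j. j \<in> {1..<k} \<Longrightarrow> q j \<ge> q (Suc j)"
    and ties: "\<And>j. j \<in> {1..<k} \<Longrightarrow> q j = q (Suc j) \<Longrightarrow> v j > v (Suc j) \<and> p j > p (Suc j)"
    and ij: "1 \<le> i" "i < j" "j \<le> k"
  shows "q i \<ge> q j \<and> (q i = q j \<longrightarrow> v i > v j \<and> p i > p j)"
proof -
  have "Suc i \<le> j" using ij by simp
  then show ?thesis using \<open>j \<le> k\<close>
  proof (induction j rule: dec_induct)
    case base
    then show ?case using ordered[of i] ties[of i] \<open>1 \<le> i\<close> by simp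
  next
    case (step l)
    then show ?case using ordered[of l] ties[of l] \<open>1 \<le> i\<close> by force
  qed
qed

theorem lemma5:
  fixes k :: nat and v p :: "nat \<Rightarrow> real"
  assumes revenue: "\<And>j. j \<in> {1..k} \<Longrightarrow> 0 \<le> v j \<and> v j < 1"
    and show_up_prob: "\<And>j. j \<in> {1..k} \<Longrightarrow> p j \<in> \<rat> \<and> 0 < p j \<and> p j \<le> 1"
    and ratio_less_1: "\<And>j. j \<in> {1..k} \<Longrightarrow> crit_ratio v p j < 1"
    and ordered: "\<And>j. j \<in> {1..<k} \<Longrightarrow> crit_ratio v p j \<ge> crit_ratio v p (Suc j)"
    and ties: "\<And>j. j \<in> {1..<k} \<Longrightarrow> crit_ratio v p j = crit_ratio v p (Suc j) \<Longrightarrow>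
                 v j > v (Suc j) \<and> p j > p (Suc j)"
  shows "\<forall>i\<in>{1..k}. \<forall>j\<in>{1..k}. i < j \<longrightarrow>
           (\<exists>R::real. \<forall>(B::nat) (y::nat \<Rightarrow> nat) (n::nat \<Rightarrow> nat) (x::nat \<Rightarrow> nat).
              offline_optimal k v p B y n x \<longrightarrow>
                real (x i) > real (n i) - R / p i \<or> real (x j) < R / p j)"
proof (intro ballI impI)
  fix i j assume ij: "i \<in> {1..k}" "j \<in> {1..k}" "i < j"
  have p: "\<forall>j\<in>{1..k}. 0 < p j \<and> p j \<le> 1" using show_up_prob by blast
  have pij: "0 < p i" "0 < p j" using p ij by auto
  obtain a b :: nat where ab: "1 \<le> a" "1 \<le> b" "real a * p i = real b * p j"
    using commensurable[of "p i" "p j"] show_up_prob ij by metis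
  have chain: "crit_ratio v p i \<ge> crit_ratio v p j"
      "crit_ratio v p i = crit_ratio v p j \<Longrightarrow> v i > v j \<and> p i > p j"
    using ratio_order_lexicographic[of k "crit_ratio v p" v p i j] ordered ties ij by auto
  \<comment> \<open>If both alternatives fail, there are \<open>c\<close> free slots of type
    \<open>i\<close> and \<open>d\<close> customers of type \<open>j\<close> to trade.\<close>
  have bound: "\<exists>R. \<forall>B y n x. offline_optimal k v p B y n x \<longrightarrow>
      real (x i) > real (n i) - R / p i \<or> real (x j) < R / p j"
    if "real c \<le> R / p i" "real d \<le> R / p j"
      and "\<And>B y n x. offline_optimal k v p B y n x \<Longrightarrow> x i + c \<le> n i \<Longrightarrow> d \<le> x j \<Longrightarrow> False"
    for R c d
  proof (intro exI[of _ R] allI impI, rule ccontr)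
    fix B y n x
    assume opt: "offline_optimal k v p B y n x"
      and "\<not> (real (x i) > real (n i) - R / p i \<or> real (x j) < R / p j)"
    then have "real (x i + c) \<le> real (n i)" "real d \<le> real (x j)" using that(1,2) by auto
    then show False using that(3)[OF opt] by simp
  qed
  show "\<exists>R. \<forall>B y n x. offline_optimal k v p B y n x \<longrightarrow>
      real (x i) > real (n i) - R / p i \<or> real (x j) < R / p j"
  proof (cases "crit_ratio v p i = crit_ratio v p j")
    case True
    have "0 < v i" "p j < p i" using chain(2)[OF True] revenue[OF ij(2)] by auto
    moreover have "real (a + 1) \<le> (real a * p i + p i) / p i" using pij by (simp add: field_simps)
    moreover have "real b \<le> (real a * p i + p i) / p j" using pij ab(3) by (simp add: field_simps)
    moreover have "i \<noteq> j" using ij(3) by simp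
    ultimately show ?thesis
      using exchange_equal_ratio[OF p _ ij(1,2) _ ab(1) _ _ ab(3) True ratio_less_1[OF ij(2)]]
      by (intro bound[of "a + 1" _ b]) blast+
  next
    case False
    define g where "g = crit_ratio v p i - crit_ratio v p j"
    have g: "0 < g" using False chain(1) by (simp add: g_def)
    have "0 < real a * p i * g\<^sup>2" using g pij ab(1) by (intro mult_pos_pos) auto
    \<comment> \<open>\<open>N\<close> is fixed before \<open>B\<close> and the vectors;
      \<open>N\<close> trades at once exceed the bound of
      \<open>exchange_larger_ratio\<close>.\<close>
    then obtain N :: nat where "4 < real N * (real a * p i * g\<^sup>2)"
      using reals_Archimedean3 by blast
    then have large: "4 < real (N * a) * p i * g\<^sup>2" by (simp add: mult.assoc)
    have eq: "real (N * a) * p i = real (N * b) * p j" using ab(3) by simp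
    show ?thesis
    proof (rule bound)
      show "real (N * a) \<le> (real (N * a) * p i) / p i" "real (N * b) \<le> (real (N * a) * p i) / p j"
        unfolding eq using pij ab(3) by (simp_all add: field_simps)
    next
      fix B y n x
      assume "offline_optimal k v p B y n x" "x i + N * a \<le> n i" "N * b \<le> x j"
      then show False
        using exchange_larger_ratio[OF p _ ij(1,2) _ _ _ eq, of v B y n x] ij(3) g large
        by (simp add: g_def)
    qed
  qed
qed

end
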